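(* Let $\Xi\subseteq\mathbb{R}^d$ be closed and bounded, let $X\subseteq\mathbb{R}^n$, and let $h\colon X\times\Xi\to\mathbb{R}$ be continuous. Let $P$ be a probability distribution supported on $\Xi$, with moments $m_k(P)=\int_\Xi \xi_1^{k_1}\cdots\xi_d^{k_d}\,P(d\xi)$ for multi-indices $k=(k_1,\dots,k_d)$ of nonnegative integers. For each $i=0,1,\dots$ let $\mathfrak{P}_i$ denote the set of probability distributions $Q$ supported on $\Xi$ whose moments satisfy $m_k(Q)=m_k(P)$ for every multi-index $k$ with $0\le k_1+\dots+k_d\le i$. For each $i$ let $$z_i=\min_{x\in X}\max_{Q\in\mathfrak{P}_i}\int_{\Xi}h(x,\xi)\,Q(d\xi)$$ be the optimal objective function value of the corresponding moment-robust optimization problem, and let $$z_{SP}=\min_{x\in X}\int_{\Xi}h(x,\xi)\,P(d\xi)$$ be the optimal objective function value of the stochastic program. Then $\lim_{i\to\infty}z_i=z_{SP}$.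
   Context: Standing assumption: all integrals (expectations) appearing exist, and all the minima and maxima in the definitions of $z_i$ and $z_{SP}$ are well-defined (in particular $X$ is nonempty and the minima over $X$ are attained). A probability distribution supported on $\Xi$ is a Borel probability measure on $\Xi$. *)

theory Defs
  imports "HOL-Probability.Probability"
begin

definition prob_distributions :: "(real ^ 'd) set \<Rightarrow> (real ^ 'd) measure set" where
  "prob_distributions \<Xi> = {Q. prob_space Q \<and> sets Q = sets (restrict_space borel \<Xi>)}"

definition moment :: "('d::finite \<Rightarrow> nat) \<Rightarrow> (real ^ 'd) measure \<Rightarrow> real" where
  "moment k Q = (\<integral>\<xi>. (\<Prod>j\<in>UNIV. (\<xi> $ j) ^ k j) \<partial>Q)"

definition ambiguity_set ::
    "(real ^ 'd::finite) set \<Rightarrow> (real ^ 'd) measure \<Rightarrow> nat \<Rightarrow> (real ^ 'd) measure set" where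
  "ambiguity_set \<Xi> P i =
     {Q \<in> prob_distributions \<Xi>. \<forall>k. (\<Sum>j\<in>UNIV. k j) \<le> i \<longrightarrow> moment k Q = moment k P}"

text \<open>Maximum and minimum of a function over a possibly infinite set. The values are meaningful
  only when attained, that is, when \<^const>\<open>is_arg_max\<close> (resp. \<^const>\<open>is_arg_min\<close>) has a witness.\<close>

definition max_value :: "('a \<Rightarrow> real) \<Rightarrow> 'a set \<Rightarrow> real" where
  "max_value f S = (GREATEST v. v \<in> f ` S)"

definition min_value :: "('a \<Rightarrow> real) \<Rightarrow> 'a set \<Rightarrow> real" where
  "min_value f S = (LEAST v. v \<in> f ` S)"

definition expected_value ::
    "((real ^ 'n) \<times> (real ^ 'd) \<Rightarrow> real) \<Rightarrow> real ^ 'n \<Rightarrow> (real ^ 'd) measure \<Rightarrow> real" where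
  "expected_value h x Q = (\<integral>\<xi>. h (x, \<xi>) \<partial>Q)"

definition worst_case_value ::
    "((real ^ 'n) \<times> (real ^ 'd::finite) \<Rightarrow> real) \<Rightarrow> (real ^ 'd) set \<Rightarrow> (real ^ 'd) measure
      \<Rightarrow> nat \<Rightarrow> real ^ 'n \<Rightarrow> real" where
  "worst_case_value h \<Xi> P i x = max_value (expected_value h x) (ambiguity_set \<Xi> P i)"

definition z_robust ::
    "((real ^ 'n) \<times> (real ^ 'd::finite) \<Rightarrow> real) \<Rightarrow> (real ^ 'n) set \<Rightarrow> (real ^ 'd) set
      \<Rightarrow> (real ^ 'd) measure \<Rightarrow> nat \<Rightarrow> real" where
  "z_robust h X \<Xi> P i = min_value (worst_case_value h \<Xi> P i) X"

definition z_SP ::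
    "((real ^ 'n) \<times> (real ^ 'd) \<Rightarrow> real) \<Rightarrow> (real ^ 'n) set \<Rightarrow> (real ^ 'd) measure \<Rightarrow> real" where
  "z_SP h X P = min_value (\<lambda>x. expected_value h x P) X"

end

theory Submission imports Defs begin

text \<open>
  Let \<open>x\<close> be an optimal solution of the stochastic program. The
  Stone--Weierstrass theorem gives a polynomial that is within \<open>\<epsilon>\<close> of \<open>h (x, \<cdot>)\<close> on the compact
  set \<open>\<Xi>\<close>; once \<open>i\<close> reaches its degree, every \<open>Q\<close> in the ambiguity set integrates it exactly as
  \<open>P\<close> does, so the expectations of \<open>h (x, \<cdot>)\<close> under \<open>Q\<close> and \<open>P\<close> differ by at most \<open>2 \<epsilon>\<close>
  (\<open>ambiguity_set_expectation_close\<close>). Hence \<open>z\<^sub>i\<close>, being at most the worst case at \<open>x\<close>, is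
  eventually at most \<open>z\<^sub>S\<^sub>P + 2 \<epsilon>\<close>. Conversely \<open>P\<close> itself lies in every ambiguity set, so
  \<open>z\<^sub>i \<ge> z\<^sub>S\<^sub>P\<close> for all \<open>i\<close>.
\<close>

lemma max_value_eq:
  assumes "is_arg_max f (\<lambda>x. x \<in> S) a"
  shows "max_value f S = f a"
  unfolding max_value_def
  by (rule Greatest_equality) (use assms in \<open>auto simp: is_arg_max_linorder\<close>)

lemma min_value_eq:
  assumes "is_arg_min f (\<lambda>x. x \<in> S) a"
  shows "min_value f S = f a"
  unfolding min_value_def
  by (rule Least_equality) (use assms in \<open>auto simp: is_arg_min_linorder\<close>)

lemma space_prob_distributions:
  assumes "Q \<in> prob_distributions \<Xi>"
  shows "space Q = \<Xi>"
  using assms sets_eq_imp_space_eq[of Q "restrict_space borel \<Xi>"]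
  by (auto simp: prob_distributions_def space_restrict_space)

lemma integrable_continuous_prob_distributions:
  fixes f :: "real ^ 'd \<Rightarrow> real"
  assumes "Q \<in> prob_distributions \<Xi>" "compact \<Xi>" "continuous_on \<Xi> f"
  shows "integrable Q f"
proof -
  interpret prob_space Q using assms(1) by (simp add: prob_distributions_def)
  obtain B where B: "\<And>\<xi>. \<xi> \<in> \<Xi> \<Longrightarrow> \<bar>f \<xi>\<bar> \<le> B"
    using compact_imp_bounded[OF compact_continuous_image[OF assms(3,2)]]
    by (auto simp: bounded_iff)
  have "f \<in> borel_measurable (restrict_space borel \<Xi>)"
    by (rule borel_measurable_continuous_on_restrict[OF assms(3)])
  then have "f \<in> borel_measurable Q"
    using assms(1) by (simp add: prob_distributions_def cong: measurable_cong_sets)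
  then show ?thesis
    by (intro integrable_const_bound[where B = B])
      (auto simp: space_prob_distributions[OF assms(1)] B)
qed

section \<open>Polynomials as combinations of monomials\<close>

definition monomial :: "('d::finite \<Rightarrow> nat) \<Rightarrow> real ^ 'd \<Rightarrow> real" where
  "monomial k \<xi> = (\<Prod>j\<in>UNIV. (\<xi> $ j) ^ k j)"

lemma monomial_mult: "monomial k \<xi> * monomial l \<xi> = monomial (\<lambda>j. k j + l j) \<xi>"
  by (simp add: monomial_def power_add prod.distrib)

lemma monomial_zero: "monomial (\<lambda>_. 0) \<xi> = 1"
  by (simp add: monomial_def)

lemma monomial_unit: "monomial (\<lambda>i. if i = j then 1 else 0) \<xi> = \<xi> $ j"
proof -
  have "monomial (\<lambda>i. if i = j then 1 else 0) \<xi> = (\<Prod>i\<in>UNIV. if i = j then \<xi> $ i else 1)"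
    unfolding monomial_def by (rule prod.cong) auto
  then show ?thesis by simp
qed

lemma continuous_on_monomial: "continuous_on S (monomial k)"
  unfolding monomial_def by (intro continuous_intros)

text \<open>
  This is the linear span of the monomials. It is generated inductively, one term at a time, so
  that an integral can be computed term by term along the derivation.
\<close>

inductive monomial_combination :: "(real ^ 'd::finite \<Rightarrow> real) \<Rightarrow> bool" where
  zero: "monomial_combination (\<lambda>_. 0)"
| add_term: "monomial_combination f \<Longrightarrow> monomial_combination (\<lambda>\<xi>. c * monomial k \<xi> + f \<xi>)"

lemma monomial_combination_term: "monomial_combination (\<lambda>\<xi>. c * monomial k \<xi>)"
  using add_term[OF zero, of c k] by simp

lemma monomial_combination_add:
  assumes "monomial_combination f" "monomial_combination g"
  shows "monomial_combination (\<lambda>\<xi>. f \<xi> + g \<xi>)"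
  using assms(1)
proof induction
  case zero
  then show ?case using assms(2) by simp
next
  case (add_term f c k)
  then show ?case using monomial_combination.add_term[of "\<lambda>\<xi>. f \<xi> + g \<xi>" c k]
    by (simp add: add.assoc)
qed

lemma monomial_combination_sum:
  assumes "finite I" "\<And>i. i \<in> I \<Longrightarrow> monomial_combination (f i)"
  shows "monomial_combination (\<lambda>\<xi>. \<Sum>i\<in>I. f i \<xi>)"
  using assms by (induction I) (auto intro: zero monomial_combination_add)

lemma monomial_combination_mult_term:
  assumes "monomial_combination g"
  shows "monomial_combination (\<lambda>\<xi>. c * monomial k \<xi> * g \<xi>)"
  using assms
proof induction
  case zero
  then show ?case by (simp add: monomial_combination.zero)
next
  case (add_term g d l)
  have "c * monomial k \<xi> * (d * monomial l \<xi> + g \<xi>)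
      = (c * d) * monomial (\<lambda>j. k j + l j) \<xi> + c * monomial k \<xi> * g \<xi>" for \<xi> :: "real ^ 'a"
    by (simp add: monomial_mult[symmetric] algebra_simps)
  then show ?case
    using monomial_combination.add_term[OF add_term.IH, of "c * d" "\<lambda>j. k j + l j"] by simp
qed

lemma monomial_combination_mult:
  assumes "monomial_combination f" "monomial_combination g"
  shows "monomial_combination (\<lambda>\<xi>. f \<xi> * g \<xi>)"
  using assms(1)
proof induction
  case zero
  then show ?case by (simp add: monomial_combination.zero)
next
  case (add_term f c k)
  then show ?case
    using monomial_combination_add[OF monomial_combination_mult_term[OF assms(2), of c k]]
    by (simp add: distrib_right)
qed

lemma continuous_on_monomial_combination:
  "monomial_combination f \<Longrightarrow> continuous_on S f"
  by (induction rule: monomial_combination.induct)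
    (auto intro!: continuous_intros continuous_on_monomial)

text \<open>
  Polynomial functions in the sense of \<^const>\<open>real_polynomial_function\<close> are built from
  constants and bounded linear functionals by sums and products; on a Euclidean space a linear
  functional is a combination of coordinates, which are monomials of degree one.
\<close>

lemma real_polynomial_function_monomial_combination:
  fixes p :: "real ^ 'd::finite \<Rightarrow> real"
  assumes "real_polynomial_function p"
  shows "monomial_combination p"
  using assms
proof induction
  case (linear f)
  then interpret bounded_linear f .
  have "monomial_combination
      (\<lambda>\<xi>. \<Sum>j\<in>UNIV. f (axis j 1) * monomial (\<lambda>i. if i = j then 1 else 0) \<xi>)"
    by (intro monomial_combination_sum monomial_combination_term) simp
  moreover have "(\<lambda>\<xi>. \<Sum>j\<in>UNIV. f (axis j 1) * monomial (\<lambda>i. if i = j then 1 else 0) \<xi>) = f"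
  proof
    fix \<xi> :: "real ^ 'd"
    have "f \<xi> = f (\<Sum>j\<in>UNIV. (\<xi> $ j) *\<^sub>R axis j 1)"
      using basis_expansion[of \<xi>] by (simp add: scalar_mult_eq_scaleR)
    then show "(\<Sum>j\<in>UNIV. f (axis j 1) * monomial (\<lambda>i. if i = j then 1 else 0) \<xi>) = f \<xi>"
      by (simp add: sum scale monomial_unit mult.commute)
  qed
  ultimately show ?case by (rule back_subst[of monomial_combination])
next
  case (const c)
  then show ?case using monomial_combination_term[of c "\<lambda>_. 0"] by (simp add: monomial_zero)
qed (auto intro: monomial_combination_add monomial_combination_mult)

section \<open>Convergence of expectations over the ambiguity sets\<close>

text \<open>
  Finitely many moments determine the integral of a polynomial; for \<open>N\<close> the largest
  degree among the monomials that make it up serves.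
\<close>

lemma ambiguity_set_integral_monomial_combination:
  assumes "monomial_combination f" "compact \<Xi>" "P \<in> prob_distributions \<Xi>"
  shows "\<exists>N. \<forall>i\<ge>N. \<forall>Q\<in>ambiguity_set \<Xi> P i. (\<integral>\<xi>. f \<xi> \<partial>Q) = (\<integral>\<xi>. f \<xi> \<partial>P)"
  using assms(1)
proof induction
  case zero
  then show ?case by simp
next
  case (add_term f c k)
  then obtain N where
    N: "\<And>i Q. N \<le> i \<Longrightarrow> Q \<in> ambiguity_set \<Xi> P i \<Longrightarrow> (\<integral>\<xi>. f \<xi> \<partial>Q) = (\<integral>\<xi>. f \<xi> \<partial>P)"
    by blast
  have split: "(\<integral>\<xi>. c * monomial k \<xi> + f \<xi> \<partial>Q) = c * moment k Q + (\<integral>\<xi>. f \<xi> \<partial>Q)"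
    if "Q \<in> prob_distributions \<Xi>" for Q
  proof -
    have "integrable Q (monomial k)" "integrable Q f"
      using integrable_continuous_prob_distributions[OF that assms(2)]
        continuous_on_monomial continuous_on_monomial_combination[OF add_term.hyps] by blast+
    moreover have "moment k Q = (\<integral>\<xi>. monomial k \<xi> \<partial>Q)"
      by (simp add: moment_def monomial_def)
    ultimately show ?thesis by simp
  qed
  have "(\<integral>\<xi>. c * monomial k \<xi> + f \<xi> \<partial>Q) = (\<integral>\<xi>. c * monomial k \<xi> + f \<xi> \<partial>P)"
    if i: "max N (\<Sum>j\<in>UNIV. k j) \<le> i" and Q: "Q \<in> ambiguity_set \<Xi> P i" for i Q
  proof -
    have "Q \<in> prob_distributions \<Xi>" "moment k Q = moment k P"
      using i Q by (auto simp: ambiguity_set_def)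
    then show ?thesis using N[of i Q] i Q by (simp add: split assms(3))
  qed
  then show ?case by blast
qed

text \<open>
  Replacing \<open>g\<close> by a uniformly close polynomial costs \<open>\<epsilon>\<close> under \<open>Q\<close> and \<open>\<epsilon>\<close> under \<open>P\<close>, since
  both are probability measures; between the two replacements the integral does not change.
\<close>

lemma ambiguity_set_expectation_close:
  fixes g :: "real ^ 'd::finite \<Rightarrow> real"
  assumes "compact \<Xi>" "P \<in> prob_distributions \<Xi>" "continuous_on \<Xi> g" "0 < \<epsilon>"
  shows "\<exists>N. \<forall>i\<ge>N. \<forall>Q\<in>ambiguity_set \<Xi> P i. \<bar>(\<integral>\<xi>. g \<xi> \<partial>Q) - (\<integral>\<xi>. g \<xi> \<partial>P)\<bar> \<le> 2 * \<epsilon>"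
proof -
  obtain p where "real_polynomial_function p" and p: "\<And>\<xi>. \<xi> \<in> \<Xi> \<Longrightarrow> \<bar>g \<xi> - p \<xi>\<bar> < \<epsilon>"
    using Stone_Weierstrass_real_polynomial_function[OF assms(1,3,4)] by blast
  then have comb: "monomial_combination p"
    by (simp add: real_polynomial_function_monomial_combination)
  have close: "\<bar>(\<integral>\<xi>. g \<xi> \<partial>Q) - (\<integral>\<xi>. p \<xi> \<partial>Q)\<bar> \<le> \<epsilon>" if Q: "Q \<in> prob_distributions \<Xi>" for Q
  proof -
    interpret prob_space Q using Q by (simp add: prob_distributions_def)
    have int: "integrable Q g" "integrable Q p"
      using integrable_continuous_prob_distributions[OF Q assms(1)] assms(3)
        continuous_on_monomial_combination[OF comb] by blast+
    have "\<bar>(\<integral>\<xi>. g \<xi> \<partial>Q) - (\<integral>\<xi>. p \<xi> \<partial>Q)\<bar> = \<bar>\<integral>\<xi>. g \<xi> - p \<xi> \<partial>Q\<bar>"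
      using int by simp
    also have "\<dots> \<le> (\<integral>\<xi>. \<bar>g \<xi> - p \<xi>\<bar> \<partial>Q)"
      by (rule integral_abs_bound)
    also have "\<dots> \<le> (\<integral>\<xi>. \<epsilon> \<partial>Q)"
      using int p by (intro integral_mono) (auto simp: space_prob_distributions[OF Q] less_imp_le)
    also have "\<dots> = \<epsilon>" by (simp add: prob_space)
    finally show ?thesis .
  qed
  obtain N where
    N: "\<And>i Q. N \<le> i \<Longrightarrow> Q \<in> ambiguity_set \<Xi> P i \<Longrightarrow> (\<integral>\<xi>. p \<xi> \<partial>Q) = (\<integral>\<xi>. p \<xi> \<partial>P)"
    using ambiguity_set_integral_monomial_combination[OF comb assms(1,2)] by blast
  have "\<bar>(\<integral>\<xi>. g \<xi> \<partial>Q) - (\<integral>\<xi>. g \<xi> \<partial>P)\<bar> \<le> 2 * \<epsilon>"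
    if i: "N \<le> i" and Q: "Q \<in> ambiguity_set \<Xi> P i" for i Q
    using N[OF i Q] close[of Q] close[OF assms(2)] Q by (auto simp: ambiguity_set_def)
  then show ?thesis by blast
qed

theorem theorem1:
  fixes \<Xi> :: "(real ^ 'd) set" and X :: "(real ^ 'n) set"
    and h :: "(real ^ 'n) \<times> (real ^ 'd) \<Rightarrow> real" and P :: "(real ^ 'd) measure"
  assumes "closed \<Xi>" and "bounded \<Xi>"
    and "continuous_on (X \<times> \<Xi>) h"
    and "P \<in> prob_distributions \<Xi>"
    and max_attained: "\<And>i x. x \<in> X \<Longrightarrow>
      \<exists>Q. is_arg_max (expected_value h x) (\<lambda>Q. Q \<in> ambiguity_set \<Xi> P i) Q"
    and min_robust_attained: "\<And>i. \<exists>x. is_arg_min (worst_case_value h \<Xi> P i) (\<lambda>x. x \<in> X) x"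
    and min_SP_attained: "\<exists>x. is_arg_min (\<lambda>x. expected_value h x P) (\<lambda>x. x \<in> X) x"
  shows "(\<lambda>i. z_robust h X \<Xi> P i) \<longlonglongrightarrow> z_SP h X P"
proof -
  have compact: "compact \<Xi>"
    using assms(1,2) by (simp add: compact_eq_bounded_closed)
  obtain x where x: "is_arg_min (\<lambda>x. expected_value h x P) (\<lambda>x. x \<in> X) x"
    using min_SP_attained by blast
  then have xX: "x \<in> X" and x_le: "\<And>y. y \<in> X \<Longrightarrow> expected_value h x P \<le> expected_value h y P"
    by (auto simp: is_arg_min_linorder)
  have z_SP: "z_SP h X P = expected_value h x P"
    unfolding z_SP_def using min_value_eq[OF x] by simp
  have lower: "z_SP h X P \<le> z_robust h X \<Xi> P i" for i
  proof -
    obtain y where y: "is_arg_min (worst_case_value h \<Xi> P i) (\<lambda>x. x \<in> X) y"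
      using min_robust_attained by blast
    then have yX: "y \<in> X" by (simp add: is_arg_min_linorder)
    obtain Q where Q: "is_arg_max (expected_value h y) (\<lambda>Q. Q \<in> ambiguity_set \<Xi> P i) Q"
      using max_attained[OF yX] by blast
    have "P \<in> ambiguity_set \<Xi> P i" using assms(4) by (simp add: ambiguity_set_def)
    then have "expected_value h y P \<le> worst_case_value h \<Xi> P i y"
      using Q max_value_eq[OF Q] by (auto simp: worst_case_value_def is_arg_max_linorder)
    then show ?thesis
      using x_le[OF yX] min_value_eq[OF y] by (simp add: z_SP z_robust_def)
  qed
  \<comment> \<open>Each \<open>z\<^sub>i\<close> is at most the worst case at the one point \<open>x\<close>, so one approximation serves all \<open>i\<close>.\<close>
  have upper: "\<exists>N. \<forall>i\<ge>N. z_robust h X \<Xi> P i \<le> z_SP h X P + 2 * \<epsilon>" if "0 < \<epsilon>" for \<epsilon> :: real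
  proof -
    have "continuous_on \<Xi> (\<lambda>\<xi>. h (x, \<xi>))"
      by (rule continuous_on_compose2[OF assms(3)]) (auto intro!: continuous_intros xX)
    from ambiguity_set_expectation_close[OF compact assms(4) this that]
    obtain N where N: "\<And>i Q. N \<le> i \<Longrightarrow> Q \<in> ambiguity_set \<Xi> P i \<Longrightarrow>
        \<bar>expected_value h x Q - expected_value h x P\<bar> \<le> 2 * \<epsilon>"
      unfolding expected_value_def by blast
    have "z_robust h X \<Xi> P i \<le> z_SP h X P + 2 * \<epsilon>" if i: "N \<le> i" for i
    proof -
      obtain y where y: "is_arg_min (worst_case_value h \<Xi> P i) (\<lambda>x. x \<in> X) y"
        using min_robust_attained by blast
      obtain Q where Q: "is_arg_max (expected_value h x) (\<lambda>Q. Q \<in> ambiguity_set \<Xi> P i) Q"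
        using max_attained[OF xX] by blast
      then have "Q \<in> ambiguity_set \<Xi> P i" by (simp add: is_arg_max_linorder)
      have "z_robust h X \<Xi> P i \<le> worst_case_value h \<Xi> P i x"
        using y xX min_value_eq[OF y] by (simp add: z_robust_def is_arg_min_linorder)
      also have "\<dots> = expected_value h x Q"
        unfolding worst_case_value_def by (rule max_value_eq[OF Q])
      also have "\<dots> \<le> expected_value h x P + 2 * \<epsilon>"
        using N[OF i \<open>Q \<in> ambiguity_set \<Xi> P i\<close>] by linarith
      finally show ?thesis by (simp add: z_SP)
    qed
    then show ?thesis by blast
  qed
  show ?thesis
  proof (rule LIMSEQ_I)
    fix r :: real assume "0 < r"
    then obtain N where N: "\<And>i. N \<le> i \<Longrightarrow> z_robust h X \<Xi> P i \<le> z_SP h X P + 2 * (r / 4)"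
      using upper[of "r / 4"] by auto
    have "norm (z_robust h X \<Xi> P i - z_SP h X P) < r" if "N \<le> i" for i
      using N[OF that] lower[of i] \<open>0 < r\<close> by simp
    then show "\<exists>N. \<forall>i\<ge>N. norm (z_robust h X \<Xi> P i - z_SP h X P) < r" by blast
  qed
qed

end
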